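(* Let $X$ be a nonempty set equipped with a separated uniformity $\mathscr U$ generated by a nonempty family $\mathscr F$ of pseudometrics with associated collection $\mathscr V$ of basic entourages, and let $G$ be a directed graph with $V(G)=X$ and $E(G)\supseteq\Delta(X)$. Suppose that $X$ is sequentially complete and has the following property: $(\ast)$ If a sequence $\{x_n\}$ converges to some $x$ in $X$ and satisfies $(x_n,x_{n+1})\in E(G)$ for all $n\ge1$, then there exists a subsequence $\{x_{n_k}\}$ of $\{x_n\}$ such that $(x_{n_k},x)\in E(G)$ for all $k\ge1$. Let $T:X\to X$ be a Banach $G$-contraction, $\mathrm{Fix}(T)$ its set of fixed points, and $X_T=\{x\in X:(x,Tx)\in E(G)\}$. Then: 1. $T|_{[x]_{\widetilde G}}$ is a Picard operator for all $x\in X_T$. 2. If $X_T$ is nonempty and $G$ is weakly connected, then $T$ is a Picard operator. 3. $\mathrm{card}(\mathrm{Fix}(T))=\mathrm{card}\{[x]_{\widetilde G}:x\in X_T\}$. 4. $T$ has a fixed point in $X$ if and only if $X_T$ is nonempty. 5. $T$ has a unique fixed point in $X$ if and only if there exists an $x\in X_T$ such that $X_T\subseteq[x]_{\widetilde G}$. 6. $T|_{X'}$ is a weakly Picard operator, where $X'=\bigcup\{[x]_{\widetilde G}:x\in X_T\}$. 7. If $X_T=X$, then $T$ is a weakly Picard operator.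
   Context: Uniform structure: $\mathscr U$ is a uniformity on $X$; separated means $\bigcap\mathscr U=\Delta(X)=\{(x,x):x\in X\}$. Convergence is in the uniform topology; $X$ is sequentially complete if every Cauchy sequence converges. $\mathscr F$ is a nonempty family of (uniformly continuous) pseudometrics on $X$ generating $\mathscr U$. For a pseudometric $\rho$ and $r>0$ put $V(\rho,r)=\{(x,y)\in X\times X:\rho(x,y)<r\}$. $\mathscr V$ is the collection of all sets $\bigcap_{i=1}^m V(\rho_i,r_i)$ with $m\ge1$, $\rho_i\in\mathscr F$, $r_i>0$; it is a base of $\mathscr U$ and its members are called basic entourages. For $V=\bigcap_{i=1}^mV(\rho_i,r_i)\in\mathscr V$ and $\alpha>0$, put $\alpha V=\bigcap_{i=1}^mV(\rho_i,\alpha r_i)$ (a basic entourage is regarded as given together with such a presentation, and $\alpha V$ is formed from it). Graphs: $G$ has vertex set $X$ and edge set $E(G)\subseteq X\times X$ (directed, no parallel edges) containing all loops. $\widetilde G$ has vertex set $X$ and $E(\widetilde G)=\{(x,y):(x,y)\in E(G)\text{ or }(y,x)\in E(G)\}$. $[x]_{\widetilde G}$ is the set of all $y\in X$ joined to $x$ by a path in $\widetilde G$, i.e. a finite sequence $x_0=x,\dots,x_N=y$ with $(x_{i-1},x_i)\in E(\widetilde G)$ for $i=1,\dots,N$. $G$ is weakly connected if $[x]_{\widetilde G}=X$ for all $x\in X$. A mapping $T:X\to X$ is a Banach $G$-contraction if (B1) $(x,y)\in E(G)$ implies $(Tx,Ty)\in E(G)$ for all $x,y\in X$; and (B2) there is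 $\alpha\in(0,1)$ such that $(x,y)\in V\cap E(G)$ implies $(Tx,Ty)\in\alpha V$ for all $x,y\in X$ and all $V\in\mathscr V$. $T$ is a Picard operator if it has a unique fixed point $x^*$ and $T^nx\to x^*$ for all $x$ in its domain; it is a weakly Picard operator if for every $x$ in its domain $\{T^nx\}$ converges to a fixed point of $T$. For $A\subseteq X$, saying that $T|_A$ is a (weakly) Picard operator means that $T(A)\subseteq A$ and that $T|_A:A\to A$ has the corresponding property on $A$ (fixed points in $A$); for $A=\emptyset$ the weakly Picard property is vacuous. *)

theory Defs
  imports "HOL-Analysis.Analysis" "HOL-Library.Equipollence"
begin

section \<open>Uniformities generated by pseudometrics\<close>

definition pseudometric :: "('a \<Rightarrow> 'a \<Rightarrow> real) \<Rightarrow> bool" where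
  "pseudometric \<rho> \<longleftrightarrow>
     (\<forall>x y. 0 \<le> \<rho> x y) \<and> (\<forall>x. \<rho> x x = 0) \<and> (\<forall>x y. \<rho> x y = \<rho> y x) \<and>
     (\<forall>x y z. \<rho> x z \<le> \<rho> x y + \<rho> y z)"

definition entourages :: "('a::uniform_space \<times> 'a) set set" where
  "entourages = {U. eventually (\<lambda>p. p \<in> U) uniformity}"

definition pm_entourage :: "('a \<Rightarrow> 'a \<Rightarrow> real) \<Rightarrow> real \<Rightarrow> ('a \<times> 'a) set" where
  "pm_entourage \<rho> r = {(x, y). \<rho> x y < r}"

text \<open>The sets \<open>pm_entourage \<rho> r\<close> form a subbase of the uniformity (compare \<open>uniformity_dist\<close>, which is
  the case of a single metric).\<close>

definition generates_uniformity :: "('a::uniform_space \<Rightarrow> 'a \<Rightarrow> real) set \<Rightarrow> bool" where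
  "generates_uniformity F \<longleftrightarrow>
     (uniformity :: ('a \<times> 'a) filter) = (INF \<rho>\<in>F. INF r\<in>{0<..}. principal (pm_entourage \<rho> r))"

text \<open>The set \<open>\<alpha>V\<close> depends on how \<open>V\<close> is written as a finite intersection. A basic entourage is
  therefore represented by a presentation, the nonempty list of the pairs \<open>(\<rho>\<^sub>i, r\<^sub>i)\<close>.\<close>

type_synonym 'a presentation = "(('a \<Rightarrow> 'a \<Rightarrow> real) \<times> real) list"

definition presentations :: "('a \<Rightarrow> 'a \<Rightarrow> real) set \<Rightarrow> 'a presentation set" where
  "presentations F = {vs. vs \<noteq> [] \<and> set vs \<subseteq> F \<times> {0<..}}"

definition entourage_of :: "'a presentation \<Rightarrow> ('a \<times> 'a) set" where
  "entourage_of vs = (\<Inter>(\<rho>, r)\<in>set vs. pm_entourage \<rho> r)"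

definition scale :: "real \<Rightarrow> 'a presentation \<Rightarrow> 'a presentation" where
  "scale \<alpha> vs = map (\<lambda>(\<rho>, r). (\<rho>, \<alpha> * r)) vs"

lemma entourages_base:
  fixes F :: "('a::uniform_space \<Rightarrow> 'a \<Rightarrow> real) set"
  assumes "generates_uniformity F" and "F \<noteq> {}"
  shows "U \<in> entourages \<longleftrightarrow> (\<exists>vs\<in>presentations F. entourage_of vs \<subseteq> U)"
proof -
  have u: "uniformity = (INF v\<in>F \<times> {0<..}. principal (case v of (\<rho>, r) \<Rightarrow> pm_entourage \<rho> r))"
    (is "_ = ?R")
  proof -
    have "(INF \<rho>\<in>F. INF r\<in>{0<..}. principal (pm_entourage \<rho> r)) = ?R" (is "?L = _")
    proof (rule order_antisym)
      show "?L \<le> ?R"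
      proof (rule INF_greatest)
        fix v assume "v \<in> F \<times> {0::real<..}"
        then obtain \<rho> r where "v = (\<rho>, r)" "\<rho> \<in> F" "r \<in> {0<..}" by auto
        then show "?L \<le> principal (case v of (\<rho>, r) \<Rightarrow> pm_entourage \<rho> r)"
          by (auto intro!: INF_lower2[of \<rho>] INF_lower)
      qed
      show "?R \<le> ?L"
      proof (intro INF_greatest)
        fix \<rho> and r :: real assume "\<rho> \<in> F" "r \<in> {0<..}"
        then show "?R \<le> principal (pm_entourage \<rho> r)"
          by (intro INF_lower2[of "(\<rho>, r)"]) auto
      qed
    qed
    with assms(1) show ?thesis unfolding generates_uniformity_def by (rule trans)
  qed
  show ?thesis
  proof
    assume "U \<in> entourages"
    then obtain W where W: "finite W" "W \<subseteq> F \<times> {0<..}"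
      and le: "(INF v\<in>W. principal (case v of (\<rho>, r) \<Rightarrow> pm_entourage \<rho> r)) \<le> principal U"
      unfolding entourages_def u mem_Collect_eq
      by (subst (asm) eventually_INF) (auto simp: le_principal)
    obtain \<rho> where "\<rho> \<in> F" using assms(2) by blast
    obtain vs where vs: "set vs = W" using W(1) finite_list by blast
    have "(\<Inter>v\<in>W. case v of (\<rho>, r) \<Rightarrow> pm_entourage \<rho> r) \<subseteq> U"
      using le W(1) by (simp add: INF_principal_finite)
    then have "entourage_of ((\<rho>, 1) # vs) \<subseteq> U"
      unfolding entourage_of_def using vs by auto
    moreover have "(\<rho>, 1) # vs \<in> presentations F"
      using W vs \<open>\<rho> \<in> F\<close> by (auto simp: presentations_def)
    ultimately show "\<exists>vs\<in>presentations F. entourage_of vs \<subseteq> U" by blast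
  next
    assume "\<exists>vs\<in>presentations F. entourage_of vs \<subseteq> U"
    then obtain vs where vs: "set vs \<subseteq> F \<times> {0<..}" "entourage_of vs \<subseteq> U"
      by (auto simp: presentations_def)
    have "uniformity \<le> (INF v\<in>set vs. principal (case v of (\<rho>, r) \<Rightarrow> pm_entourage \<rho> r))"
      unfolding u using vs(1) by (intro INF_superset_mono) auto
    also have "\<dots> = principal (entourage_of vs)"
      by (simp add: INF_principal_finite entourage_of_def)
    also have "\<dots> \<le> principal U" using vs(2) by simp
    finally show "U \<in> entourages" by (simp add: entourages_def le_principal)
  qed
qed

section \<open>Graphs on a type\<close>

text \<open>A graph whose vertex set is the whole type is given by its edge set \<open>E\<close>.\<close>

definition undirected :: "('a \<times> 'a) set \<Rightarrow> ('a \<times> 'a) set" where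
  "undirected E = {(x, y). (x, y) \<in> E \<or> (y, x) \<in> E}"

definition component :: "('a \<times> 'a) set \<Rightarrow> 'a \<Rightarrow> 'a set" where
  "component E x = {y. (x, y) \<in> (undirected E)\<^sup>*}"

lemma component_iff_path:
  "y \<in> component E x \<longleftrightarrow>
     (\<exists>N p. p 0 = x \<and> p N = y \<and> (\<forall>i<N. (p i, p (Suc i)) \<in> undirected E))"
  by (simp add: component_def rtrancl_is_UN_relpow relpow_fun_conv)

definition weakly_connected :: "('a \<times> 'a) set \<Rightarrow> bool" where
  "weakly_connected E \<longleftrightarrow> (\<forall>x. component E x = UNIV)"

section \<open>Contractions and Picard operators\<close>

definition banach_G_contraction ::
    "('a \<Rightarrow> 'a \<Rightarrow> real) set \<Rightarrow> ('a \<times> 'a) set \<Rightarrow> ('a \<Rightarrow> 'a) \<Rightarrow> bool" where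
  "banach_G_contraction F E T \<longleftrightarrow>
     (\<forall>x y. (x, y) \<in> E \<longrightarrow> (T x, T y) \<in> E) \<and>
     (\<exists>\<alpha>. 0 < \<alpha> \<and> \<alpha> < 1 \<and>
       (\<forall>x y. \<forall>vs\<in>presentations F.
          (x, y) \<in> entourage_of vs \<inter> E \<longrightarrow> (T x, T y) \<in> entourage_of (scale \<alpha> vs)))"

definition Fix :: "('a \<Rightarrow> 'a) \<Rightarrow> 'a set" where
  "Fix T = {x. T x = x}"

text \<open>In the next two definitions \<open>A\<close> is the domain: they concern the restriction of \<open>T\<close> to \<open>A\<close>.\<close>

definition picard_operator_on :: "'a::topological_space set \<Rightarrow> ('a \<Rightarrow> 'a) \<Rightarrow> bool" where
  "picard_operator_on A T \<longleftrightarrow>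
     T ` A \<subseteq> A \<and>
     (\<exists>z. Fix T \<inter> A = {z} \<and> (\<forall>x\<in>A. (\<lambda>n. (T ^^ n) x) \<longlonglongrightarrow> z))"

definition weakly_picard_operator_on :: "'a::topological_space set \<Rightarrow> ('a \<Rightarrow> 'a) \<Rightarrow> bool" where
  "weakly_picard_operator_on A T \<longleftrightarrow>
     T ` A \<subseteq> A \<and>
     (\<forall>x\<in>A. \<exists>z\<in>Fix T \<inter> A. (\<lambda>n. (T ^^ n) x) \<longlonglongrightarrow> z)"

definition X_T :: "('a \<times> 'a) set \<Rightarrow> ('a \<Rightarrow> 'a) \<Rightarrow> 'a set" where
  "X_T E T = {x. (x, T x) \<in> E}"

end

theory Submission
  imports Defs
begin

text \<open>For an edge \<open>(x, y)\<close> condition (B2), applied to \<open>V(\<rho>, r)\<close> for all \<open>r > \<rho>(x, y)\<close>, says that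
  \<open>\<rho>(Tx, Ty) \<le> \<alpha> \<rho>(x, y)\<close> for each single \<open>\<rho> \<in> F\<close>. Summing along a path, the orbits of two points of
  one component approach each other geometrically in every \<open>\<rho>\<close>. If \<open>(x, Tx)\<close> is an edge, the orbit of
  \<open>x\<close> is therefore Cauchy; the subsequence property joins it to its limit by an edge, so that the
  limit lies in the component of \<open>x\<close> and is fixed. Every fixed point carries a loop, so each
  component that meets \<open>X_T\<close> contains exactly one fixed point, and every fixed point arises in this
  way.\<close>

section \<open>Pseudometrics generating a uniformity\<close>

lemma generates_uniformity_eventually_iff:
  fixes F :: "('a::uniform_space \<Rightarrow> 'a \<Rightarrow> real) set"
  assumes "generates_uniformity F" "F \<noteq> {}"
  shows "eventually P uniformity \<longleftrightarrow>
    (\<exists>vs\<in>presentations F. \<forall>x y. (x, y) \<in> entourage_of vs \<longrightarrow> P (x, y))"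
  using entourages_base[OF assms, of "{p. P p}"]
  by (auto simp: entourages_def subset_iff)

text \<open>Each single \<open>pm_entourage \<rho> e\<close> with \<open>\<rho>\<close> in
  \<open>F\<close> is an entourage, which gives one direction. For the other, a basic entourage
  imposes only finitely many conditions, so that they eventually hold together.\<close>

lemma tendsto_iff_pseudometrics:
  fixes F :: "('a::uniform_space \<Rightarrow> 'a \<Rightarrow> real) set"
  assumes gen: "generates_uniformity F" "F \<noteq> {}" and pm: "\<forall>\<rho>\<in>F. pseudometric \<rho>"
  shows "(s \<longlongrightarrow> z) net \<longleftrightarrow> (\<forall>\<rho>\<in>F. ((\<lambda>n. \<rho> (s n) z) \<longlongrightarrow> 0) net)"
proof
  assume lim: "(s \<longlongrightarrow> z) net"
  show "\<forall>\<rho>\<in>F. ((\<lambda>n. \<rho> (s n) z) \<longlongrightarrow> 0) net"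
  proof
    fix \<rho> assume \<rho>: "\<rho> \<in> F"
    then have p: "pseudometric \<rho>" using pm by blast
    show "((\<lambda>n. \<rho> (s n) z) \<longlongrightarrow> 0) net"
    proof (rule tendstoI)
      fix e :: real assume "e > 0"
      then have "[(\<rho>, e)] \<in> presentations F" using \<rho> by (simp add: presentations_def)
      then have "eventually (\<lambda>(x, y). \<rho> x y < e) uniformity"
        unfolding generates_uniformity_eventually_iff[OF gen]
        by (intro bexI[of _ "[(\<rho>, e)]"]) (auto simp: entourage_of_def pm_entourage_def)
      \<comment> \<open>Neighbourhoods of \<open>z\<close> are read off from the pairs with first
        component \<open>z\<close>, whereas the claim has \<open>z\<close> as second argument of
        \<open>\<rho>\<close>; symmetry swaps the two.\<close>
      then have "eventually (\<lambda>(x, y). \<rho> y x < e) uniformity"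
        using p by (simp add: pseudometric_def)
      then have "eventually (\<lambda>y. \<rho> y z < e) (nhds z)"
        unfolding eventually_nhds_uniformity by (auto elim!: eventually_mono)
      with lim have "eventually (\<lambda>n. \<rho> (s n) z < e) net"
        by (auto simp: filterlim_iff)
      then show "eventually (\<lambda>n. dist (\<rho> (s n) z) 0 < e) net"
        using p by (simp add: pseudometric_def)
    qed
  qed
next
  assume lim: "\<forall>\<rho>\<in>F. ((\<lambda>n. \<rho> (s n) z) \<longlongrightarrow> 0) net"
  show "(s \<longlongrightarrow> z) net"
    unfolding filterlim_iff
  proof (intro allI impI)
    fix P assume "eventually P (nhds z)"
    then obtain vs where vs: "vs \<in> presentations F"
      and P: "\<And>x y. (x, y) \<in> entourage_of vs \<Longrightarrow> x = z \<Longrightarrow> P y"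
      unfolding eventually_nhds_uniformity generates_uniformity_eventually_iff[OF gen] by auto
    have "\<forall>v\<in>set vs. eventually (\<lambda>n. (z, s n) \<in> pm_entourage (fst v) (snd v)) net"
    proof
      fix v assume "v \<in> set vs"
      then have v: "fst v \<in> F" "snd v > 0" using vs by (auto simp: presentations_def)
      with lim have "eventually (\<lambda>n. fst v (s n) z < snd v) net"
        by (intro order_tendstoD(2)[of _ 0]) auto
      then show "eventually (\<lambda>n. (z, s n) \<in> pm_entourage (fst v) (snd v)) net"
        using v pm by (simp add: pm_entourage_def pseudometric_def)
    qed
    then have "eventually (\<lambda>n. \<forall>v\<in>set vs. (z, s n) \<in> pm_entourage (fst v) (snd v)) net"
      by (intro eventually_ball_finite) auto
    then show "eventually (\<lambda>n. P (s n)) net"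
      by (rule eventually_mono) (rule P, auto simp: entourage_of_def)
  qed
qed

text \<open>A presentation is a finite list, so the largest of the thresholds belonging to its
  entries works for the whole entourage.\<close>

lemma Cauchy_if_pseudometrics:
  fixes F :: "('a::uniform_space \<Rightarrow> 'a \<Rightarrow> real) set"
  assumes gen: "generates_uniformity F" "F \<noteq> {}"
    and s: "\<And>\<rho> e. \<rho> \<in> F \<Longrightarrow> e > 0 \<Longrightarrow> \<exists>N. \<forall>m\<ge>N. \<forall>n\<ge>N. \<rho> (s m) (s n) < e"
  shows "Cauchy s"
  unfolding Cauchy_uniform_iff
proof (intro allI impI)
  fix P :: "'a \<times> 'a \<Rightarrow> bool" assume "eventually P uniformity"
  then obtain vs where vs: "vs \<in> presentations F"
    and P: "\<And>x y. (x, y) \<in> entourage_of vs \<Longrightarrow> P (x, y)"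
    unfolding generates_uniformity_eventually_iff[OF gen] by auto
  have "\<forall>v\<in>set vs. \<exists>N. \<forall>m\<ge>N. \<forall>n\<ge>N. fst v (s m) (s n) < snd v"
    using vs by (auto simp: presentations_def intro!: s)
  then obtain N where N: "\<And>v m n. v \<in> set vs \<Longrightarrow> m \<ge> N v \<Longrightarrow> n \<ge> N v \<Longrightarrow> fst v (s m) (s n) < snd v"
    by metis
  have "P (s n, s m)" if "n \<ge> Max (N ` set vs)" "m \<ge> Max (N ` set vs)" for n m
  proof (rule P)
    have "N v \<le> Max (N ` set vs)" if "v \<in> set vs" for v using that by simp
    then have "fst v (s n) (s m) < snd v" if "v \<in> set vs" for v
      using that \<open>n \<ge> _\<close> \<open>m \<ge> _\<close> by (meson N order_trans)
    then show "(s n, s m) \<in> entourage_of vs"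
      by (fastforce simp: entourage_of_def pm_entourage_def)
  qed
  then show "\<exists>N. \<forall>n\<ge>N. \<forall>m\<ge>N. P (s n, s m)" by blast
qed

text \<open>All radii in a presentation are positive, so a pair at distance 0 for every
  \<open>\<rho>\<close> lies in every basic entourage, hence in every entourage.\<close>

lemma separated_pseudometrics_eq:
  fixes F :: "('a::uniform_space \<Rightarrow> 'a \<Rightarrow> real) set"
  assumes sep: "\<Inter>(entourages :: ('a \<times> 'a) set set) = Id"
    and gen: "generates_uniformity F" "F \<noteq> {}"
    and zero: "\<And>\<rho>. \<rho> \<in> F \<Longrightarrow> \<rho> x y = 0"
  shows "x = y"
proof -
  have "(x, y) \<in> U" if U: "U \<in> entourages" for U
  proof -
    obtain vs where vs: "vs \<in> presentations F" "entourage_of vs \<subseteq> U"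
      using iffD1[OF entourages_base[OF gen] U] by (rule bexE)
    have "\<rho> x y < r" if "(\<rho>, r) \<in> set vs" for \<rho> r
      using that vs(1) zero[of \<rho>] by (auto simp: presentations_def)
    then have "(x, y) \<in> entourage_of vs"
      by (auto simp: entourage_of_def pm_entourage_def)
    with vs(2) show ?thesis by (rule subsetD)
  qed
  then have "(x, y) \<in> \<Inter>entourages" by (rule InterI)
  then show ?thesis unfolding sep by simp
qed

lemma pseudometric_geometric_bound:
  assumes pm: "pseudometric \<rho>" and a: "0 < a" "a < 1"
    and step: "\<And>n. \<rho> (s n) (s (Suc n)) \<le> a ^ n * C"
  shows "\<rho> (s n) (s (n + k)) \<le> a ^ n * C / (1 - a)"
proof -
  have C: "C \<ge> 0" using step[of 0] pm by (auto simp: pseudometric_def intro: order_trans)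
  \<comment> \<open>The final bound does not reproduce itself under induction on \<open>k\<close>;
    the exact value of the partial geometric sum does. The factor \<open>1 - a ^ k\<close> is
    dropped afterwards, which uses \<open>C \<ge> 0\<close>.\<close>
  have "\<rho> (s n) (s (n + k)) \<le> a ^ n * C * (1 - a ^ k) / (1 - a)"
  proof (induction k)
    case 0
    then show ?case using pm by (simp add: pseudometric_def)
  next
    case (Suc k)
    have "\<rho> (s n) (s (n + Suc k)) \<le> \<rho> (s n) (s (n + k)) + \<rho> (s (n + k)) (s (Suc (n + k)))"
      using pm by (simp add: pseudometric_def)
    also have "\<dots> \<le> a ^ n * C * (1 - a ^ k) / (1 - a) + a ^ (n + k) * C"
      using Suc.IH step by (rule add_mono)
    also have "\<dots> = a ^ n * C * (1 - a ^ Suc k) / (1 - a)"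
      using a by (simp add: field_simps power_add)
    finally show ?case .
  qed
  also have "\<dots> \<le> a ^ n * C / (1 - a)"
    using a C by (intro divide_right_mono) (auto simp: mult_left_le)
  finally show ?thesis .
qed

lemma pseudometric_geometric_Cauchy:
  assumes pm: "pseudometric \<rho>" and a: "0 < a" "a < 1"
    and step: "\<And>n. \<rho> (s n) (s (Suc n)) \<le> a ^ n * C" and e: "e > 0"
  shows "\<exists>N. \<forall>m\<ge>N. \<forall>n\<ge>N. \<rho> (s m) (s n) < e"
proof -
  \<comment> \<open>The factor 2 comes from comparing both \<open>s m\<close> and \<open>s n\<close>
    with \<open>s N\<close>, which avoids distinguishing the order of \<open>m\<close> and
    \<open>n\<close>.\<close>
  have "(\<lambda>n. a ^ n * (2 * C / (1 - a))) \<longlonglongrightarrow> 0"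
    using a by (intro tendsto_mult_left_zero LIMSEQ_realpow_zero) auto
  then have "eventually (\<lambda>n. a ^ n * (2 * C / (1 - a)) < e) sequentially"
    using e by (rule order_tendstoD)
  then obtain N where N: "a ^ N * (2 * C / (1 - a)) < e"
    by (auto simp: eventually_sequentially)
  have b: "\<rho> (s N) (s m) \<le> a ^ N * C / (1 - a)" if "m \<ge> N" for m
    using pseudometric_geometric_bound[OF pm a step, of N "m - N"] that by simp
  have "\<rho> (s m) (s n) < e" if "m \<ge> N" "n \<ge> N" for m n
  proof -
    have "\<rho> (s m) (s n) \<le> \<rho> (s N) (s m) + \<rho> (s N) (s n)"
      using pm by (metis pseudometric_def)
    also have "\<dots> \<le> a ^ N * C / (1 - a) + a ^ N * C / (1 - a)"
      using b that by (intro add_mono) auto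
    also have "\<dots> = a ^ N * (2 * C / (1 - a))" by (simp add: field_simps)
    finally show ?thesis using N by simp
  qed
  then show ?thesis by blast
qed

section \<open>Components of a graph\<close>

lemma component_refl: "x \<in> component E x"
  by (simp add: component_def)

text \<open>The reflexive transitive closure of a symmetric relation is an equivalence, and
  components are its classes. This allows any member of a component to serve as its base
  point.\<close>

lemma component_eq_iff: "component E x = component E y \<longleftrightarrow> y \<in> component E x"
proof -
  have "sym ((undirected E)\<^sup>*)"
    by (intro sym_rtrancl) (auto simp: undirected_def sym_def)
  then show ?thesis
    unfolding component_def set_eq_iff mem_Collect_eq
    by (meson rtrancl.rtrancl_refl rtrancl_trans symD)
qed

section \<open>Graph contractions\<close>

text \<open>Condition (B2) enters only as the estimate \<open>contr\<close> for each pseudometric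
  separately, with one constant \<open>a\<close> for all of \<open>F\<close>. Presentations thus
  disappear from the arguments about orbits.\<close>

locale G_contraction =
  fixes F :: "('a::uniform_space \<Rightarrow> 'a \<Rightarrow> real) set"
    and E :: "('a \<times> 'a) set" and T :: "'a \<Rightarrow> 'a" and a :: real
  assumes separated: "\<Inter>(entourages :: ('a \<times> 'a) set set) = Id"
    and gen: "generates_uniformity F" "F \<noteq> {}"
    and pm: "\<forall>\<rho>\<in>F. pseudometric \<rho>"
    and seq_complete: "\<forall>s :: nat \<Rightarrow> 'a. Cauchy s \<longrightarrow> convergent s"
    and star: "\<forall>(s :: nat \<Rightarrow> 'a) x. s \<longlonglongrightarrow> x \<and> (\<forall>n. (s n, s (Suc n)) \<in> E) \<longrightarrow>
                 (\<exists>r :: nat \<Rightarrow> nat. strict_mono r \<and> (\<forall>k. (s (r k), x) \<in> E))"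
    and edge: "(x, y) \<in> E \<Longrightarrow> (T x, T y) \<in> E"
    and a: "0 < a" "a < 1"
    and contr: "\<rho> \<in> F \<Longrightarrow> (x, y) \<in> E \<Longrightarrow> \<rho> (T x) (T y) \<le> a * \<rho> x y"
begin

lemma pseudometric: "\<rho> \<in> F \<Longrightarrow> pseudometric \<rho>"
  using pm by blast

lemma tendsto_iff: "(s \<longlongrightarrow> z) net \<longleftrightarrow> (\<forall>\<rho>\<in>F. ((\<lambda>n. \<rho> (s n) z) \<longlongrightarrow> 0) net)"
  using tendsto_iff_pseudometrics[OF gen pm] .

lemma edge_funpow: "(x, y) \<in> E \<Longrightarrow> ((T ^^ n) x, (T ^^ n) y) \<in> E"
  by (induction n) (auto intro: edge)

text \<open>Edges are mapped to edges, so the contraction estimate can be iterated; the symmetry of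
  \<open>\<rho>\<close> then covers edges traversed backwards.\<close>

lemma undirected_funpow_le:
  assumes "\<rho> \<in> F" "(x, y) \<in> undirected E"
  shows "\<rho> ((T ^^ n) x) ((T ^^ n) y) \<le> a ^ n * \<rho> x y"
proof -
  have *: "\<rho> ((T ^^ n) x) ((T ^^ n) y) \<le> a ^ n * \<rho> x y" if "(x, y) \<in> E" for x y
  proof (induction n)
    case (Suc n)
    have "\<rho> ((T ^^ Suc n) x) ((T ^^ Suc n) y) \<le> a * \<rho> ((T ^^ n) x) ((T ^^ n) y)"
      using contr[OF assms(1) edge_funpow[OF that]] by simp
    also have "\<dots> \<le> a * (a ^ n * \<rho> x y)" using Suc.IH a by (intro mult_left_mono) auto
    finally show ?case by (simp add: mult.assoc)
  qed simp
  have "\<rho> u v = \<rho> v u" for u v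
    using pseudometric[OF assms(1)] by (simp add: pseudometric_def)
  then show ?thesis using assms(2) *[of x y] *[of y x] by (auto simp: undirected_def)
qed

lemma component_funpow_le:
  assumes \<rho>: "\<rho> \<in> F" and "y \<in> component E x"
  shows "\<exists>C. \<forall>n. \<rho> ((T ^^ n) x) ((T ^^ n) y) \<le> a ^ n * C"
proof -
  have "(x, y) \<in> (undirected E)\<^sup>*" using assms(2) by (simp add: component_def)
  then show ?thesis
  proof (induction rule: rtrancl_induct)
    case base
    then show ?case using pseudometric[OF \<rho>] by (intro exI[of _ 0]) (simp add: pseudometric_def)
  next
    case (step y z)
    then obtain C where C: "\<And>n. \<rho> ((T ^^ n) x) ((T ^^ n) y) \<le> a ^ n * C" by blast
    \<comment> \<open>The constant is the \<open>\<rho>\<close>-length of the chosen path: it starts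
      at 0 and grows by \<open>\<rho> y z\<close> with each edge. It depends on
      \<open>\<rho>\<close> but not on \<open>n\<close>.\<close>
    have "\<rho> ((T ^^ n) x) ((T ^^ n) z) \<le> a ^ n * (C + \<rho> y z)" for n
    proof -
      have "\<rho> ((T ^^ n) x) ((T ^^ n) z) \<le>
          \<rho> ((T ^^ n) x) ((T ^^ n) y) + \<rho> ((T ^^ n) y) ((T ^^ n) z)"
        using pseudometric[OF \<rho>] by (simp add: pseudometric_def)
      also have "\<dots> \<le> a ^ n * C + a ^ n * \<rho> y z"
        using C undirected_funpow_le[OF \<rho> step.hyps(2)] by (rule add_mono)
      finally show ?thesis by (simp add: distrib_left)
    qed
    then show ?case by blast
  qed
qed

lemma component_funpow_tendsto:
  assumes \<rho>: "\<rho> \<in> F" and "y \<in> component E x"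
  shows "(\<lambda>n. \<rho> ((T ^^ n) x) ((T ^^ n) y)) \<longlonglongrightarrow> 0"
proof -
  obtain C where C: "\<And>n. \<rho> ((T ^^ n) x) ((T ^^ n) y) \<le> a ^ n * C"
    using component_funpow_le[OF assms] by blast
  have "(\<lambda>n. a ^ n * C) \<longlonglongrightarrow> 0"
    using a by (intro tendsto_mult_left_zero LIMSEQ_realpow_zero) auto
  then show ?thesis
    by (rule tendsto_sandwich[rotated 3])
      (use C pseudometric[OF \<rho>] in \<open>auto simp: pseudometric_def\<close>)
qed

lemma eqI: "(\<And>\<rho>. \<rho> \<in> F \<Longrightarrow> \<rho> x y = 0) \<Longrightarrow> x = y"
  using separated_pseudometrics_eq[OF separated gen] by blast

text \<open>The orbits of fixed points are constant, so the distances that tend to 0 within a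
  component all equal \<open>\<rho> z w\<close>.\<close>

lemma Fix_component_unique:
  assumes "z \<in> Fix T" "w \<in> Fix T" "w \<in> component E z"
  shows "z = w"
proof (rule eqI)
  fix \<rho> assume "\<rho> \<in> F"
  have fixed: "(T ^^ n) u = u" if "u \<in> Fix T" for n u
    using that by (induction n) (auto simp: Fix_def)
  show "\<rho> z w = 0"
    using component_funpow_tendsto[OF \<open>\<rho> \<in> F\<close> assms(3)] assms
    by (simp add: fixed LIMSEQ_const_iff)
qed

text \<open>\<open>T\<close> carries a path from \<open>x\<close> to \<open>y\<close> to a path from
  \<open>T x\<close> to \<open>T y\<close>; the edge from \<open>x\<close> to \<open>T x\<close> is
  put in front of it.\<close>

lemma image_component:
  assumes "x \<in> X_T E T"
  shows "T ` component E x \<subseteq> component E x"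
proof
  fix w assume "w \<in> T ` component E x"
  then obtain y where y: "(x, y) \<in> (undirected E)\<^sup>*" "w = T y" by (auto simp: component_def)
  have "(T x, T y) \<in> (undirected E)\<^sup>*"
    using y(1)
  proof (induction rule: rtrancl_induct)
    case (step u v)
    then have "(T u, T v) \<in> undirected E" using edge by (auto simp: undirected_def)
    with step.IH show ?case by (rule rtrancl_into_rtrancl)
  qed simp
  moreover have "(x, T x) \<in> undirected E" using assms by (simp add: X_T_def undirected_def)
  ultimately show "w \<in> component E x"
    using y(2) by (simp add: component_def converse_rtrancl_into_rtrancl)
qed

lemma orbit_tendsto_Fix:
  assumes x: "x \<in> X_T E T"
  shows "\<exists>z\<in>Fix T \<inter> component E x. (\<lambda>n. (T ^^ n) x) \<longlonglongrightarrow> z"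
proof -
  let ?s = "\<lambda>n. (T ^^ n) x"
  have edges: "(?s n, ?s (Suc n)) \<in> E" for n
    using edge_funpow[of x "T x" n] x by (simp add: X_T_def funpow_swap1)
  have "Cauchy ?s"
  proof (rule Cauchy_if_pseudometrics[OF gen])
    fix \<rho> and e :: real assume \<rho>: "\<rho> \<in> F" and "e > 0"
    have "\<rho> (?s n) (?s (Suc n)) \<le> a ^ n * \<rho> x (T x)" for n
      using undirected_funpow_le[OF \<rho>, of x "T x" n] x
      by (simp add: X_T_def undirected_def funpow_swap1)
    then show "\<exists>N. \<forall>m\<ge>N. \<forall>n\<ge>N. \<rho> (?s m) (?s n) < e"
      by (rule pseudometric_geometric_Cauchy[OF pseudometric[OF \<rho>] a]) fact
  qed
  then obtain z where z: "?s \<longlonglongrightarrow> z" using seq_complete by (auto simp: convergent_def)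
  then obtain r :: "nat \<Rightarrow> nat" where r: "strict_mono r" "\<And>k. (?s (r k), z) \<in> E"
    using star edges by metis
  have orbit: "?s n \<in> component E x" for n
    by (induction n) (use image_component[OF x] in \<open>auto simp: component_refl\<close>)
  \<comment> \<open>A single edge from the orbit to the limit suffices for membership in the
    component; the whole subsequence is used below to show that \<open>z\<close> is fixed.\<close>
  have "(?s (r 0), z) \<in> undirected E" using r(2)[of 0] by (simp add: undirected_def)
  with orbit[of "r 0"] have "z \<in> component E x"
    by (simp add: component_def rtrancl_into_rtrancl)
  moreover have "z = T z"
  proof (rule eqI)
    fix \<rho> assume \<rho>: "\<rho> \<in> F"
    have p: "\<rho> u v = \<rho> v u" "\<rho> u v \<ge> 0" "\<rho> u w \<le> \<rho> u v + \<rho> v w" for u v w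
      using pseudometric[OF \<rho>] by (auto simp: pseudometric_def)
    have s: "(\<lambda>n. \<rho> (?s n) z) \<longlonglongrightarrow> 0" using z \<rho> by (simp add: tendsto_iff)
    have s1: "(\<lambda>k. \<rho> (?s (r k)) z) \<longlonglongrightarrow> 0"
      using LIMSEQ_subseq_LIMSEQ[OF s r(1)] by (simp add: o_def)
    have s2: "(\<lambda>k. \<rho> (?s (Suc (r k))) z) \<longlonglongrightarrow> 0"
      using LIMSEQ_subseq_LIMSEQ[OF LIMSEQ_Suc[OF s] r(1)] by (simp add: o_def)
    \<comment> \<open>\<open>T\<close> is not known to be continuous at \<open>z\<close>. Along the
      subsequence, however, \<open>(?s (r k), z)\<close> is an edge, so the contraction estimate
      bounds the distance from \<open>?s (Suc (r k))\<close> to \<open>T z\<close>.\<close>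
    have "\<rho> z (T z) \<le> \<rho> (?s (Suc (r k))) z + a * \<rho> (?s (r k)) z" for k
    proof -
      have "\<rho> z (T z) \<le> \<rho> (?s (Suc (r k))) z + \<rho> (?s (Suc (r k))) (T z)"
        using p(3)[of z "T z" "?s (Suc (r k))"] p(1)[of z "?s (Suc (r k))"] by simp
      also have "\<rho> (?s (Suc (r k))) (T z) \<le> a * \<rho> (?s (r k)) z"
        using contr[OF \<rho> r(2)] by simp
      finally show ?thesis by simp
    qed
    moreover have "(\<lambda>k. \<rho> (?s (Suc (r k))) z + a * \<rho> (?s (r k)) z) \<longlonglongrightarrow> 0"
      using tendsto_add[OF s2 tendsto_mult_right_zero[OF s1]] by simp
    ultimately have "\<rho> z (T z) \<le> 0" by (intro LIMSEQ_le_const) auto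
    then show "\<rho> z (T z) = 0" using p(2)[of z "T z"] by simp
  qed
  ultimately show ?thesis using z by (auto simp: Fix_def)
qed

lemma picard_operator_on_component:
  assumes x: "x \<in> X_T E T"
  shows "picard_operator_on (component E x) T"
proof -
  obtain z where z: "z \<in> Fix T" "z \<in> component E x" and lim: "(\<lambda>n. (T ^^ n) x) \<longlonglongrightarrow> z"
    using orbit_tendsto_Fix[OF x] by blast
  have "Fix T \<inter> component E x = {z}"
    \<comment> \<open>Uniqueness is available for components based at a fixed point, so the
      component of \<open>x\<close> is rewritten as that of \<open>z\<close>.\<close>
    using z Fix_component_unique[OF z(1)] component_eq_iff[of E x z] by auto
  moreover have "(\<lambda>n. (T ^^ n) y) \<longlonglongrightarrow> z" if y: "y \<in> component E x" for y
    unfolding tendsto_iff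
  proof
    fix \<rho> assume \<rho>: "\<rho> \<in> F"
    have p: "\<rho> u v = \<rho> v u" "\<rho> u v \<ge> 0" "\<rho> u w \<le> \<rho> u v + \<rho> v w" for u v w
      using pseudometric[OF \<rho>] by (auto simp: pseudometric_def)
    \<comment> \<open>The orbit of \<open>y\<close> approaches the orbit of \<open>x\<close>, which
      tends to \<open>z\<close>; the sum dominates the distance from the orbit of \<open>y\<close>
      to \<open>z\<close>.\<close>
    have "(\<lambda>n. \<rho> ((T ^^ n) x) ((T ^^ n) y) + \<rho> ((T ^^ n) x) z) \<longlonglongrightarrow> 0"
      using tendsto_add[OF component_funpow_tendsto[OF \<rho> y], of _ 0] lim \<rho>
      by (simp add: tendsto_iff)
    moreover have "\<rho> ((T ^^ n) y) z \<le> \<rho> ((T ^^ n) x) ((T ^^ n) y) + \<rho> ((T ^^ n) x) z" for n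
      using p(3)[of "(T ^^ n) y" z "(T ^^ n) x"] p(1)[of "(T ^^ n) y" "(T ^^ n) x"] by simp
    ultimately show "(\<lambda>n. \<rho> ((T ^^ n) y) z) \<longlonglongrightarrow> 0"
      using p(2) by (intro tendsto_sandwich[of "\<lambda>_. 0" "\<lambda>n. \<rho> ((T ^^ n) y) z"]) auto
  qed
  ultimately show ?thesis
    using image_component[OF x] by (auto simp: picard_operator_on_def)
qed

end

lemma banach_G_contraction_le:
  assumes "banach_G_contraction F E T" and pm: "\<forall>\<rho>\<in>F. pseudometric \<rho>"
  shows "\<exists>a. 0 < a \<and> a < 1 \<and> (\<forall>\<rho>\<in>F. \<forall>x y. (x, y) \<in> E \<longrightarrow> \<rho> (T x) (T y) \<le> a * \<rho> x y)"
proof -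
  obtain a where a: "0 < a" "a < 1"
    and B2: "\<And>x y vs. vs \<in> presentations F \<Longrightarrow> (x, y) \<in> entourage_of vs \<Longrightarrow> (x, y) \<in> E \<Longrightarrow>
      (T x, T y) \<in> entourage_of (scale a vs)"
    using assms(1) unfolding banach_G_contraction_def by blast
  have "\<rho> (T x) (T y) \<le> a * \<rho> x y" if \<rho>: "\<rho> \<in> F" and e: "(x, y) \<in> E" for \<rho> x y
  proof (rule field_le_epsilon)
    fix d :: real assume d: "d > 0"
    have "\<rho> x y \<ge> 0" using \<rho> pm by (simp add: pseudometric_def)
    \<comment> \<open>Membership in \<open>pm_entourage\<close> is strict, so the radius must exceed
      \<open>\<rho> x y\<close>. The excess \<open>d / a\<close> is chosen so that scaling by
      \<open>a\<close> yields the radius \<open>a * \<rho> x y + d\<close>.\<close>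
    then have r: "\<rho> x y + d / a > \<rho> x y" "\<rho> x y + d / a > 0"
      using d a by (auto intro: add_nonneg_pos)
    then have "(T x, T y) \<in> entourage_of (scale a [(\<rho>, \<rho> x y + d / a)])"
      using \<rho> e by (intro B2) (auto simp: presentations_def entourage_of_def pm_entourage_def)
    then show "\<rho> (T x) (T y) \<le> a * \<rho> x y + d"
      using a by (simp add: scale_def entourage_of_def pm_entourage_def distrib_left)
  qed
  with a show ?thesis by blast
qed

theorem theorem2:
  fixes F :: "('a::uniform_space \<Rightarrow> 'a \<Rightarrow> real) set"
    and E :: "('a \<times> 'a) set"
    and T :: "'a \<Rightarrow> 'a"
  assumes separated: "\<Inter>(entourages :: ('a \<times> 'a) set set) = Id"
    and F_nonempty: "F \<noteq> {}"
    and F_pseudometric: "\<forall>\<rho>\<in>F. pseudometric \<rho>"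
    and F_generates: "generates_uniformity F"
    and loops: "Id \<subseteq> E"
    and seq_complete: "\<forall>s :: nat \<Rightarrow> 'a. Cauchy s \<longrightarrow> convergent s"
    and star: "\<forall>(s :: nat \<Rightarrow> 'a) x. s \<longlonglongrightarrow> x \<and> (\<forall>n. (s n, s (Suc n)) \<in> E) \<longrightarrow>
                 (\<exists>r :: nat \<Rightarrow> nat. strict_mono r \<and> (\<forall>k. (s (r k), x) \<in> E))"
    and contraction: "banach_G_contraction F E T"
  shows "(\<forall>x\<in>X_T E T. picard_operator_on (component E x) T) \<and>
         (X_T E T \<noteq> {} \<and> weakly_connected E \<longrightarrow> picard_operator_on UNIV T) \<and>
         Fix T \<approx> {component E x | x. x \<in> X_T E T} \<and>
         ((\<exists>x. x \<in> Fix T) \<longleftrightarrow> X_T E T \<noteq> {}) \<and>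
         ((\<exists>!x. x \<in> Fix T) \<longleftrightarrow> (\<exists>x\<in>X_T E T. X_T E T \<subseteq> component E x)) \<and>
         weakly_picard_operator_on (\<Union>{component E x | x. x \<in> X_T E T}) T \<and>
         (X_T E T = UNIV \<longrightarrow> weakly_picard_operator_on UNIV T)"
proof -
  obtain a where a: "0 < a" "a < 1"
      "\<forall>\<rho>\<in>F. \<forall>x y. (x, y) \<in> E \<longrightarrow> \<rho> (T x) (T y) \<le> a * \<rho> x y"
    using banach_G_contraction_le[OF contraction F_pseudometric] by blast
  interpret G_contraction F E T a
    using separated F_nonempty F_pseudometric F_generates seq_complete star contraction a
    by unfold_locales (auto simp: banach_G_contraction_def)
  let ?X = "X_T E T" and ?X' = "\<Union>{component E x | x. x \<in> X_T E T}"
  have picard: "picard_operator_on (component E x) T" if "x \<in> ?X" for x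
    using picard_operator_on_component[OF that] .
  have Fix_X: "Fix T \<subseteq> ?X" using loops by (auto simp: Fix_def X_T_def)
  have ex_Fix: "\<exists>z. z \<in> Fix T \<and> z \<in> component E x" if "x \<in> ?X" for x
    using orbit_tendsto_Fix[OF that] by blast
  have c2: "picard_operator_on UNIV T" if "?X \<noteq> {}" "weakly_connected E"
    using that picard by (metis all_not_in_conv weakly_connected_def)
  \<comment> \<open>The bijection sends a fixed point to its component. It is injective because a
    component holds at most one fixed point, and surjective because each component in question can
    be based at the fixed point it contains.\<close>
  have "bij_betw (component E) (Fix T) {component E x | x. x \<in> ?X}"
    unfolding bij_betw_def
  proof
    show "inj_on (component E) (Fix T)"
      by (auto simp: inj_on_def component_eq_iff intro: Fix_component_unique)
    show "component E ` Fix T = {component E x | x. x \<in> ?X}"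
    proof
      show "component E ` Fix T \<subseteq> {component E x | x. x \<in> ?X}" using Fix_X by auto
      show "{component E x | x. x \<in> ?X} \<subseteq> component E ` Fix T"
      proof clarify
        fix x assume "x \<in> ?X"
        then obtain z where "z \<in> Fix T" "z \<in> component E x" using ex_Fix by blast
        then show "component E x \<in> component E ` Fix T" by (metis component_eq_iff image_eqI)
      qed
    qed
  qed
  then have c3: "Fix T \<approx> {component E x | x. x \<in> ?X}" by (auto simp: eqpoll_def)
  have c4: "(\<exists>x. x \<in> Fix T) \<longleftrightarrow> ?X \<noteq> {}" using Fix_X ex_Fix by blast
  have c5: "(\<exists>!x. x \<in> Fix T) \<longleftrightarrow> (\<exists>x\<in>?X. ?X \<subseteq> component E x)"
  proof
    assume "\<exists>!x. x \<in> Fix T"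
    then obtain z where z: "z \<in> Fix T" "\<And>w. w \<in> Fix T \<Longrightarrow> w = z" by blast
    \<comment> \<open>The component of \<open>x\<close> contains some fixed point, which can only be
      \<open>z\<close>.\<close>
    have "x \<in> component E z" if "x \<in> ?X" for x
      using ex_Fix[OF that] z(2) by (metis component_eq_iff component_refl)
    then show "\<exists>x\<in>?X. ?X \<subseteq> component E x" using z(1) Fix_X by blast
  next
    assume "\<exists>x\<in>?X. ?X \<subseteq> component E x"
    then obtain x where x: "x \<in> ?X" "?X \<subseteq> component E x" by blast
    obtain z where "Fix T \<inter> component E x = {z}"
      using picard[OF x(1)] unfolding picard_operator_on_def by blast
    \<comment> \<open>All fixed points lie in \<open>?X\<close>, hence in this one component, where
      the Picard property leaves exactly one.\<close>
    moreover have "Fix T \<subseteq> component E x" using Fix_X x(2) by blast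
    ultimately have "Fix T = {z}" by (simp add: Int_absorb2)
    then show "\<exists>!x. x \<in> Fix T" by simp
  qed
  have c6: "weakly_picard_operator_on ?X' T"
    unfolding weakly_picard_operator_on_def
  proof
    show "T ` ?X' \<subseteq> ?X'" using image_component by blast
    show "\<forall>y\<in>?X'. \<exists>z\<in>Fix T \<inter> ?X'. (\<lambda>n. (T ^^ n) y) \<longlonglongrightarrow> z"
    proof
      fix y assume "y \<in> ?X'"
      then obtain x where x: "x \<in> ?X" "y \<in> component E x" by blast
      then obtain z where "Fix T \<inter> component E x = {z}" "(\<lambda>n. (T ^^ n) y) \<longlonglongrightarrow> z"
        using picard[OF x(1)] unfolding picard_operator_on_def by blast
      then show "\<exists>z\<in>Fix T \<inter> ?X'. (\<lambda>n. (T ^^ n) y) \<longlonglongrightarrow> z" using x(1) by blast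
    qed
  qed
  have c7: "weakly_picard_operator_on UNIV T" if "?X = UNIV"
  proof -
    \<comment> \<open>Every point now belongs to \<open>?X\<close> and lies in its own component, so
      the preceding claim already concerns the whole space.\<close>
    have "y \<in> ?X'" for y using that component_refl[of y E] by auto
    then have "?X' = UNIV" by blast
    then show ?thesis using c6 by simp
  qed
  show ?thesis
    by (intro conjI ballI impI picard c2 c3 c4 c5 c6 c7) auto
qed

end
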